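(* Let $(M,+,0,\wedge)$ be a meet-monoid, let $H$ be the Grothendieck group of the monoid $(M,+,0)$, and let $\varphi\colon M\to H$ be the canonical monoid morphism. Then: (1) there is a unique meet-monoid structure on $H$ such that $\varphi$ is a morphism of ordered sets; (2) $(H,+,-,0,\wedge)$ is a lattice-ordered group, and it is the lattice-ordered group freely generated by the meet-monoid $(M,+,0,\wedge)$ (in the sense of the left adjoint of the forgetful functor); (3) if $M$ is cancellative, i.e. $a+x=b+x$ implies $a=b$ in $M$, then $\varphi$ is an embedding of meet-monoids.
   Context: Monoids are commutative. A meet-monoid is a commutative monoid $(M,+,0)$ equipped with an idempotent, commutative, associative law $\wedge$ (inducing the order $x\le y$ iff $x\wedge y=x$, no greatest element required) such that $x+(y\wedge z)=(x+y)\wedge(x+z)$. The Grothendieck group of a commutative monoid is the group freely generated by it (left adjoint to the forgetful functor). A lattice-ordered group is a commutative group with a lattice order such that addition distributes over meet and join.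
   Formalization: In (1), "φ is a morphism of ordered sets" is taken as "φ preserves ∧": with φ merely monotone, uniqueness fails, e.g. for M = N² with componentwise order and H = Z², where both the componentwise and the lexicographic order make φ monotone. *)

theory Defs
  imports "HOL-Algebra.Group"
begin

section \<open>Meet-monoids and lattice-ordered groups\<close>

text \<open>
  Monoids are the multiplicatively written records of \<^theory>\<open>HOL-Algebra.Group\<close>: the sum
  $x + y$ and the element $0$ of the additive notation are \<open>x \<otimes> y\<close> and \<open>\<one>\<close>.
  The meet is a separate operation, so that one can speak of the different meet-monoid structures
  on a fixed monoid.
\<close>

locale meet_monoid = comm_monoid M for M (structure) +
  fixes wedge :: "'a \<Rightarrow> 'a \<Rightarrow> 'a" (infixl \<open>\<curlywedge>\<close> 75)
  assumes wedge_closed: "\<lbrakk>x \<in> carrier M; y \<in> carrier M\<rbrakk> \<Longrightarrow> x \<curlywedge> y \<in> carrier M"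
    and wedge_idem: "x \<in> carrier M \<Longrightarrow> x \<curlywedge> x = x"
    and wedge_comm: "\<lbrakk>x \<in> carrier M; y \<in> carrier M\<rbrakk> \<Longrightarrow> x \<curlywedge> y = y \<curlywedge> x"
    and wedge_assoc: "\<lbrakk>x \<in> carrier M; y \<in> carrier M; z \<in> carrier M\<rbrakk>
      \<Longrightarrow> (x \<curlywedge> y) \<curlywedge> z = x \<curlywedge> (y \<curlywedge> z)"
    and mult_wedge_distrib: "\<lbrakk>x \<in> carrier M; y \<in> carrier M; z \<in> carrier M\<rbrakk>
      \<Longrightarrow> x \<otimes> (y \<curlywedge> z) = (x \<otimes> y) \<curlywedge> (x \<otimes> z)"

definition meet_order :: "('a, 'b) monoid_scheme \<Rightarrow> ('a \<Rightarrow> 'a \<Rightarrow> 'a) \<Rightarrow> 'a gorder" where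
  "meet_order M wedge = \<lparr>carrier = carrier M, eq = (=), le = (\<lambda>x y. wedge x y = x)\<rparr>"

text \<open>
  A lattice-ordered group is presented by its group and its meet. The join is the one
  determined by the order; \<open>wedge\<close> is automatically the meet of that order, and the distributivity
  of \<open>\<otimes>\<close> over it is part of \<^locale>\<open>meet_monoid\<close>. In this presentation the forgetful functor to
  meet-monoids is the identity on the data.
\<close>

locale lattice_ordered_group = comm_group G + meet_monoid G wedge
  for G (structure) and wedge (infixl \<open>\<curlywedge>\<close> 75) +
  assumes lattice_order: "lattice (meet_order G (\<curlywedge>))"
    and mult_join_distrib: "\<lbrakk>x \<in> carrier G; y \<in> carrier G; z \<in> carrier G\<rbrakk>
      \<Longrightarrow> x \<otimes> (y \<squnion>\<^bsub>meet_order G (\<curlywedge>)\<^esub> z)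
            = (x \<otimes> y) \<squnion>\<^bsub>meet_order G (\<curlywedge>)\<^esub> (x \<otimes> z)"

section \<open>Morphisms\<close>

text \<open>\<^const>\<open>hom\<close> does not require the unit to be preserved.\<close>

definition monoid_hom :: "('a, 'c) monoid_scheme \<Rightarrow> ('b, 'd) monoid_scheme \<Rightarrow> ('a \<Rightarrow> 'b) \<Rightarrow> bool"
  where "monoid_hom M N f \<longleftrightarrow> f \<in> hom M N \<and> f \<one>\<^bsub>M\<^esub> = \<one>\<^bsub>N\<^esub>"

definition meet_monoid_hom :: "('a, 'c) monoid_scheme \<Rightarrow> ('a \<Rightarrow> 'a \<Rightarrow> 'a) \<Rightarrow>
    ('b, 'd) monoid_scheme \<Rightarrow> ('b \<Rightarrow> 'b \<Rightarrow> 'b) \<Rightarrow> ('a \<Rightarrow> 'b) \<Rightarrow> bool" where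
  "meet_monoid_hom M wM N wN f \<longleftrightarrow> monoid_hom M N f \<and>
     (\<forall>x \<in> carrier M. \<forall>y \<in> carrier M. f (wM x y) = wN (f x) (f y))"

definition meet_monoid_embedding :: "('a, 'c) monoid_scheme \<Rightarrow> ('a \<Rightarrow> 'a \<Rightarrow> 'a) \<Rightarrow>
    ('b, 'd) monoid_scheme \<Rightarrow> ('b \<Rightarrow> 'b \<Rightarrow> 'b) \<Rightarrow> ('a \<Rightarrow> 'b) \<Rightarrow> bool" where
  "meet_monoid_embedding M wM N wN f \<longleftrightarrow>
     meet_monoid_hom M wM N wN f \<and> inj_on f (carrier M)"

definition lattice_ordered_group_hom :: "('a, 'c) monoid_scheme \<Rightarrow> ('a \<Rightarrow> 'a \<Rightarrow> 'a) \<Rightarrow>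
    ('b, 'd) monoid_scheme \<Rightarrow> ('b \<Rightarrow> 'b \<Rightarrow> 'b) \<Rightarrow> ('a \<Rightarrow> 'b) \<Rightarrow> bool" where
  "lattice_ordered_group_hom G wG N wN f \<longleftrightarrow> meet_monoid_hom G wG N wN f \<and>
     (\<forall>x \<in> carrier G. \<forall>y \<in> carrier G.
        f (x \<squnion>\<^bsub>meet_order G wG\<^esub> y) = f x \<squnion>\<^bsub>meet_order N wN\<^esub> f y)"

text \<open>
  Meet-monoid structures on \<open>H\<close> making the monoid morphism \<open>\<phi> : M \<rightarrow> H\<close> a morphism for the order
  structures given by the meets, that is, a morphism of meet-semilattices. Monotonicity alone would
  not determine the structure: for $M = \mathbb{N}^2$ with the componentwise order and
  $H = \mathbb{Z}^2$, the inclusion is monotone both for the componentwise and for the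
  lexicographic order on $H$, and both make $H$ a lattice-ordered group.

  The operation is a function in the set-theoretic sense, defined exactly on the carrier, so that
  its uniqueness can be stated as an equality.
\<close>

definition compatible_meet :: "('a, 'c) monoid_scheme \<Rightarrow> ('a \<Rightarrow> 'a \<Rightarrow> 'a) \<Rightarrow>
    ('b, 'd) monoid_scheme \<Rightarrow> ('a \<Rightarrow> 'b) \<Rightarrow> ('b \<Rightarrow> 'b \<Rightarrow> 'b) \<Rightarrow> bool" where
  "compatible_meet M wM H \<phi> wH \<longleftrightarrow>
     wH \<in> carrier H \<rightarrow>\<^sub>E (carrier H \<rightarrow>\<^sub>E carrier H) \<and>
     meet_monoid H wH \<and> meet_monoid_hom M wM H wH \<phi>"

section \<open>Universal properties\<close>

text \<open>
  The \<open>itself\<close> argument names the type that contains the carriers of the test objects \<open>G\<close>.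
\<close>

definition universal_group :: "'g itself \<Rightarrow> 'm monoid \<Rightarrow> 'h monoid \<Rightarrow> ('m \<Rightarrow> 'h) \<Rightarrow> bool" where
  "universal_group (_ :: 'g itself) M H \<phi> \<longleftrightarrow> comm_group H \<and> monoid_hom M H \<phi> \<and>
     (\<forall>(G :: 'g monoid) f. comm_group G \<longrightarrow> monoid_hom M G f \<longrightarrow>
        (\<exists>!h. h \<in> carrier H \<rightarrow>\<^sub>E carrier G \<and> monoid_hom H G h \<and>
              (\<forall>x \<in> carrier M. h (\<phi> x) = f x)))"

definition universal_lattice_ordered_group ::
  "'g itself \<Rightarrow> 'm monoid \<Rightarrow> ('m \<Rightarrow> 'm \<Rightarrow> 'm) \<Rightarrow> 'h monoid \<Rightarrow> ('h \<Rightarrow> 'h \<Rightarrow> 'h) \<Rightarrow> ('m \<Rightarrow> 'h) \<Rightarrow> bool"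
  where
  "universal_lattice_ordered_group (_ :: 'g itself) M wM H wH \<phi> \<longleftrightarrow>
     lattice_ordered_group H wH \<and> meet_monoid_hom M wM H wH \<phi> \<and>
     (\<forall>(G :: 'g monoid) wG f.
        lattice_ordered_group G wG \<longrightarrow> meet_monoid_hom M wM G wG f \<longrightarrow>
        (\<exists>!h. h \<in> carrier H \<rightarrow>\<^sub>E carrier G \<and> lattice_ordered_group_hom H wH G wG h \<and>
              (\<forall>x \<in> carrier M. h (\<phi> x) = f x)))"

text \<open>
  A definition cannot quantify over the type \<open>'g\<close>. It is enough to require the universal property
  for the two types below: by \<open>grothendieck_group_universal\<close> it then holds for every type, and by
  \<open>grothendieck_group_exists\<close> every commutative monoid has a Grothendieck group.
\<close>

definition grothendieck_group :: "'m monoid \<Rightarrow> 'h monoid \<Rightarrow> ('m \<Rightarrow> 'h) \<Rightarrow> bool" where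
  "grothendieck_group M H \<phi> \<longleftrightarrow>
     universal_group TYPE('h) M H \<phi> \<and> universal_group TYPE(('m \<times> 'm) set) M H \<phi>"

section \<open>Existence of the Grothendieck group\<close>

definition diff_rel :: "'m monoid \<Rightarrow> (('m \<times> 'm) \<times> ('m \<times> 'm)) set" where
  "diff_rel M = {((a, b), (c, d)). a \<in> carrier M \<and> b \<in> carrier M \<and> c \<in> carrier M \<and> d \<in> carrier M \<and>
     (\<exists>e \<in> carrier M. a \<otimes>\<^bsub>M\<^esub> d \<otimes>\<^bsub>M\<^esub> e = c \<otimes>\<^bsub>M\<^esub> b \<otimes>\<^bsub>M\<^esub> e)}"

definition diff_class :: "'m monoid \<Rightarrow> 'm \<Rightarrow> 'm \<Rightarrow> ('m \<times> 'm) set" where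
  "diff_class M a b = diff_rel M `` {(a, b)}"

definition diff_group :: "'m monoid \<Rightarrow> ('m \<times> 'm) set monoid" where
  "diff_group M = \<lparr>carrier = {diff_class M a b | a b. a \<in> carrier M \<and> b \<in> carrier M},
     mult = (\<lambda>X Y. \<Union>(a, b) \<in> X. \<Union>(c, d) \<in> Y. diff_class M (a \<otimes>\<^bsub>M\<^esub> c) (b \<otimes>\<^bsub>M\<^esub> d)),
     one = diff_class M \<one>\<^bsub>M\<^esub> \<one>\<^bsub>M\<^esub>\<rparr>"

context comm_monoid
begin

lemma diff_rel_trans_aux:
  assumes "a \<in> carrier G" "b \<in> carrier G" "c \<in> carrier G" "d \<in> carrier G"
    "x \<in> carrier G" "y \<in> carrier G" "e \<in> carrier G" "k \<in> carrier G"
    and "a \<otimes> d \<otimes> e = c \<otimes> b \<otimes> e" "c \<otimes> y \<otimes> k = x \<otimes> d \<otimes> k"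
  shows "a \<otimes> y \<otimes> (d \<otimes> e \<otimes> k) = x \<otimes> b \<otimes> (d \<otimes> e \<otimes> k)"
proof -
  have "a \<otimes> y \<otimes> (d \<otimes> e \<otimes> k) = (a \<otimes> d \<otimes> e) \<otimes> (y \<otimes> k)"
    using assms(1-8) by (simp add: m_ac)
  also have "\<dots> = (c \<otimes> y \<otimes> k) \<otimes> (b \<otimes> e)"
    unfolding assms(9) using assms(1-8) by (simp add: m_ac)
  also have "\<dots> = x \<otimes> b \<otimes> (d \<otimes> e \<otimes> k)"
    unfolding assms(10) using assms(1-8) by (simp add: m_ac)
  finally show ?thesis .
qed

end

lemma diff_rel_equiv:
  assumes "comm_monoid M"
  shows "equiv (carrier M \<times> carrier M) (diff_rel M)"
proof -
  interpret comm_monoid M by fact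
  show ?thesis
  proof (rule equivI)
    show "diff_rel M \<subseteq> (carrier M \<times> carrier M) \<times> (carrier M \<times> carrier M)"
      by (auto simp: diff_rel_def)
    show "refl_on (carrier M \<times> carrier M) (diff_rel M)"
      by (auto simp: refl_on_def diff_rel_def)
    show "sym (diff_rel M)"
      by (auto simp: sym_def diff_rel_def) (metis)+
    show "trans (diff_rel M)"
    proof (rule transI)
      fix p q r assume pq: "(p, q) \<in> diff_rel M" and qr: "(q, r) \<in> diff_rel M"
      obtain a b c d x y where [simp]: "p = (a, b)" "q = (c, d)" "r = (x, y)"
        by (metis surj_pair)
      from pq qr obtain e k where mem: "a \<in> carrier M" "b \<in> carrier M" "c \<in> carrier M"
          "d \<in> carrier M" "x \<in> carrier M" "y \<in> carrier M" "e \<in> carrier M" "k \<in> carrier M"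
        and "a \<otimes>\<^bsub>M\<^esub> d \<otimes>\<^bsub>M\<^esub> e = c \<otimes>\<^bsub>M\<^esub> b \<otimes>\<^bsub>M\<^esub> e" "c \<otimes>\<^bsub>M\<^esub> y \<otimes>\<^bsub>M\<^esub> k = x \<otimes>\<^bsub>M\<^esub> d \<otimes>\<^bsub>M\<^esub> k"
        by (auto simp: diff_rel_def)
      then have "a \<otimes>\<^bsub>M\<^esub> y \<otimes>\<^bsub>M\<^esub> (d \<otimes>\<^bsub>M\<^esub> e \<otimes>\<^bsub>M\<^esub> k) = x \<otimes>\<^bsub>M\<^esub> b \<otimes>\<^bsub>M\<^esub> (d \<otimes>\<^bsub>M\<^esub> e \<otimes>\<^bsub>M\<^esub> k)"
        by (rule diff_rel_trans_aux)
      moreover have "d \<otimes>\<^bsub>M\<^esub> e \<otimes>\<^bsub>M\<^esub> k \<in> carrier M" using mem by simp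
      ultimately show "(p, r) \<in> diff_rel M"
        using mem unfolding diff_rel_def by auto
    qed
  qed
qed

lemma diff_class_eq_iff:
  assumes "comm_monoid M" "a \<in> carrier M" "b \<in> carrier M" "c \<in> carrier M" "d \<in> carrier M"
  shows "diff_class M a b = diff_class M c d \<longleftrightarrow>
    (\<exists>e \<in> carrier M. a \<otimes>\<^bsub>M\<^esub> d \<otimes>\<^bsub>M\<^esub> e = c \<otimes>\<^bsub>M\<^esub> b \<otimes>\<^bsub>M\<^esub> e)"
  using eq_equiv_class_iff[OF diff_rel_equiv[OF assms(1)], of "(a, b)" "(c, d)"] assms
  by (simp add: diff_class_def diff_rel_def)

lemma diff_group_mult:
  assumes "comm_monoid M" "a \<in> carrier M" "b \<in> carrier M" "c \<in> carrier M" "d \<in> carrier M"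
  shows "diff_class M a b \<otimes>\<^bsub>diff_group M\<^esub> diff_class M c d
    = diff_class M (a \<otimes>\<^bsub>M\<^esub> c) (b \<otimes>\<^bsub>M\<^esub> d)"
proof -
  interpret comm_monoid M by fact
  have ab: "(a, b) \<in> diff_class M a b" and cd: "(c, d) \<in> diff_class M c d"
    using assms by (auto simp: diff_class_def diff_rel_def)
  have eq: "diff_class M (a' \<otimes>\<^bsub>M\<^esub> c') (b' \<otimes>\<^bsub>M\<^esub> d') = diff_class M (a \<otimes>\<^bsub>M\<^esub> c) (b \<otimes>\<^bsub>M\<^esub> d)"
    if "(a', b') \<in> diff_class M a b" "(c', d') \<in> diff_class M c d" for a' b' c' d'
  proof -
    from that obtain e k where mem: "a' \<in> carrier M" "b' \<in> carrier M" "c' \<in> carrier M"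
      "d' \<in> carrier M" "e \<in> carrier M" "k \<in> carrier M"
      and e: "a \<otimes>\<^bsub>M\<^esub> b' \<otimes>\<^bsub>M\<^esub> e = a' \<otimes>\<^bsub>M\<^esub> b \<otimes>\<^bsub>M\<^esub> e" and k: "c \<otimes>\<^bsub>M\<^esub> d' \<otimes>\<^bsub>M\<^esub> k = c' \<otimes>\<^bsub>M\<^esub> d \<otimes>\<^bsub>M\<^esub> k"
      by (auto simp: diff_class_def diff_rel_def)
    have "(a' \<otimes>\<^bsub>M\<^esub> c') \<otimes>\<^bsub>M\<^esub> (b \<otimes>\<^bsub>M\<^esub> d) \<otimes>\<^bsub>M\<^esub> (e \<otimes>\<^bsub>M\<^esub> k) = (a' \<otimes>\<^bsub>M\<^esub> b \<otimes>\<^bsub>M\<^esub> e) \<otimes>\<^bsub>M\<^esub> (c' \<otimes>\<^bsub>M\<^esub> d \<otimes>\<^bsub>M\<^esub> k)"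
      using mem assms(2-5) by (simp add: m_ac)
    also have "\<dots> = (a \<otimes>\<^bsub>M\<^esub> c) \<otimes>\<^bsub>M\<^esub> (b' \<otimes>\<^bsub>M\<^esub> d') \<otimes>\<^bsub>M\<^esub> (e \<otimes>\<^bsub>M\<^esub> k)"
      unfolding e[symmetric] k[symmetric] using mem assms(2-5) by (simp add: m_ac)
    finally show ?thesis
      using mem assms by (subst diff_class_eq_iff) auto
  qed
  show ?thesis
  proof
    show "diff_class M a b \<otimes>\<^bsub>diff_group M\<^esub> diff_class M c d
        \<subseteq> diff_class M (a \<otimes>\<^bsub>M\<^esub> c) (b \<otimes>\<^bsub>M\<^esub> d)"
      by (auto simp: diff_group_def eq)
    show "diff_class M (a \<otimes>\<^bsub>M\<^esub> c) (b \<otimes>\<^bsub>M\<^esub> d)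
        \<subseteq> diff_class M a b \<otimes>\<^bsub>diff_group M\<^esub> diff_class M c d"
      by (rule subsetI, unfold diff_group_def monoid.simps, rule UN_I[OF ab], simp,
          rule bexI[OF _ cd], simp)
  qed
qed

lemma diff_group_carrier: "X \<in> carrier (diff_group M) \<longleftrightarrow>
    (\<exists>a \<in> carrier M. \<exists>b \<in> carrier M. X = diff_class M a b)"
  by (auto simp: diff_group_def)

lemma diff_group_one: "\<one>\<^bsub>diff_group M\<^esub> = diff_class M \<one>\<^bsub>M\<^esub> \<one>\<^bsub>M\<^esub>"
  by (simp add: diff_group_def)

lemma diff_group_comm_group:
  assumes "comm_monoid M"
  shows "comm_group (diff_group M)"
proof -
  interpret comm_monoid M by fact
  note dm = diff_group_mult[OF assms]
  show ?thesis
  proof (rule comm_groupI)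
    fix X Y assume "X \<in> carrier (diff_group M)" "Y \<in> carrier (diff_group M)"
    then show "X \<otimes>\<^bsub>diff_group M\<^esub> Y \<in> carrier (diff_group M)"
      unfolding diff_group_carrier by (metis dm m_closed)
  next
    show "\<one>\<^bsub>diff_group M\<^esub> \<in> carrier (diff_group M)"
      unfolding diff_group_carrier diff_group_one by blast
  next
    fix X Y Z
    assume "X \<in> carrier (diff_group M)" "Y \<in> carrier (diff_group M)" "Z \<in> carrier (diff_group M)"
    then show "X \<otimes>\<^bsub>diff_group M\<^esub> Y \<otimes>\<^bsub>diff_group M\<^esub> Z
        = X \<otimes>\<^bsub>diff_group M\<^esub> (Y \<otimes>\<^bsub>diff_group M\<^esub> Z)"
      unfolding diff_group_carrier by (auto simp: dm m_assoc)
  next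
    fix X Y assume "X \<in> carrier (diff_group M)" "Y \<in> carrier (diff_group M)"
    then show "X \<otimes>\<^bsub>diff_group M\<^esub> Y = Y \<otimes>\<^bsub>diff_group M\<^esub> X"
      unfolding diff_group_carrier by (auto simp: dm m_comm)
  next
    fix X assume "X \<in> carrier (diff_group M)"
    then show "\<one>\<^bsub>diff_group M\<^esub> \<otimes>\<^bsub>diff_group M\<^esub> X = X"
      unfolding diff_group_carrier diff_group_one by (auto simp: dm)
  next
    fix X assume "X \<in> carrier (diff_group M)"
    then obtain a b where ab: "a \<in> carrier M" "b \<in> carrier M" "X = diff_class M a b"
      unfolding diff_group_carrier by blast
    have "diff_class M b a \<otimes>\<^bsub>diff_group M\<^esub> X = \<one>\<^bsub>diff_group M\<^esub>"
      using ab assms by (auto simp: dm diff_group_one diff_class_eq_iff m_comm)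
    moreover have "diff_class M b a \<in> carrier (diff_group M)"
      unfolding diff_group_carrier using ab by blast
    ultimately show "\<exists>Y \<in> carrier (diff_group M). Y \<otimes>\<^bsub>diff_group M\<^esub> X = \<one>\<^bsub>diff_group M\<^esub>"
      by (rule bexI)
  qed
qed

abbreviation diff_map :: "'m monoid \<Rightarrow> 'm \<Rightarrow> ('m \<times> 'm) set" where
  "diff_map M \<equiv> \<lambda>a. diff_class M a \<one>\<^bsub>M\<^esub>"

lemma diff_map_hom:
  assumes "comm_monoid M"
  shows "monoid_hom M (diff_group M) (diff_map M)"
proof -
  interpret comm_monoid M by fact
  show ?thesis
    using diff_group_mult[OF assms]
    by (fastforce simp: monoid_hom_def hom_def diff_group_carrier diff_group_one)
qed

lemma diff_group_universal:
  assumes "comm_monoid M"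
  shows "universal_group TYPE('g) M (diff_group M) (diff_map M)"
  unfolding universal_group_def
proof (intro conjI allI impI)
  interpret comm_monoid M by fact
  let ?Q = "diff_group M"
  interpret Q: comm_group ?Q by (rule diff_group_comm_group[OF assms])
  show "comm_group ?Q" ..
  show "monoid_hom M ?Q (diff_map M)" by (rule diff_map_hom[OF assms])
  fix G :: "'g monoid" and f
  assume "comm_group G" and f: "monoid_hom M G f"
  interpret G: comm_group G by fact
  have fc [simp]: "f x \<in> carrier G" if "x \<in> carrier M" for x
    using f that by (auto simp: monoid_hom_def hom_def)
  have fm: "f (x \<otimes>\<^bsub>M\<^esub> y) = f x \<otimes>\<^bsub>G\<^esub> f y" if "x \<in> carrier M" "y \<in> carrier M" for x y
    using f that by (auto simp: monoid_hom_def hom_def)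
  have f1 [simp]: "f \<one>\<^bsub>M\<^esub> = \<one>\<^bsub>G\<^esub>"
    using f by (simp add: monoid_hom_def)
  define h where "h = (\<lambda>X \<in> carrier ?Q. THE z. \<exists>a \<in> carrier M. \<exists>b \<in> carrier M.
    X = diff_class M a b \<and> z = f a \<otimes>\<^bsub>G\<^esub> inv\<^bsub>G\<^esub> f b)"
  have h: "h (diff_class M a b) = f a \<otimes>\<^bsub>G\<^esub> inv\<^bsub>G\<^esub> f b" if ab: "a \<in> carrier M" "b \<in> carrier M" for a b
  proof -
    have *: "f c \<otimes>\<^bsub>G\<^esub> inv\<^bsub>G\<^esub> f d = f a \<otimes>\<^bsub>G\<^esub> inv\<^bsub>G\<^esub> f b"
      if cd: "c \<in> carrier M" "d \<in> carrier M" and eq: "diff_class M a b = diff_class M c d" for c d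
    proof -
      from eq obtain e where e: "e \<in> carrier M" "a \<otimes>\<^bsub>M\<^esub> d \<otimes>\<^bsub>M\<^esub> e = c \<otimes>\<^bsub>M\<^esub> b \<otimes>\<^bsub>M\<^esub> e"
        using ab cd assms by (auto simp: diff_class_eq_iff)
      then have "f a \<otimes>\<^bsub>G\<^esub> f d \<otimes>\<^bsub>G\<^esub> f e = f c \<otimes>\<^bsub>G\<^esub> f b \<otimes>\<^bsub>G\<^esub> f e"
        using ab cd by (metis fm m_closed)
      then have "f a \<otimes>\<^bsub>G\<^esub> f d = f c \<otimes>\<^bsub>G\<^esub> f b"
        using ab cd e by (metis G.m_closed G.right_cancel fc)
      moreover have cancel: "x \<otimes>\<^bsub>G\<^esub> inv\<^bsub>G\<^esub> y = (x \<otimes>\<^bsub>G\<^esub> z) \<otimes>\<^bsub>G\<^esub> (inv\<^bsub>G\<^esub> z \<otimes>\<^bsub>G\<^esub> inv\<^bsub>G\<^esub> y)"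
        if "x \<in> carrier G" "y \<in> carrier G" "z \<in> carrier G" for x y z
        using that by (metis G.inv_closed G.m_assoc G.m_closed G.r_inv G.r_one)
      ultimately have "f c \<otimes>\<^bsub>G\<^esub> inv\<^bsub>G\<^esub> f d
          = (f a \<otimes>\<^bsub>G\<^esub> f d) \<otimes>\<^bsub>G\<^esub> (inv\<^bsub>G\<^esub> f b \<otimes>\<^bsub>G\<^esub> inv\<^bsub>G\<^esub> f d)"
        using ab cd by (metis fc)
      also have "\<dots> = f a \<otimes>\<^bsub>G\<^esub> inv\<^bsub>G\<^esub> f b"
        using ab cd cancel[of "f a" "f b" "f d"] by (simp add: G.m_comm[of "inv\<^bsub>G\<^esub> f b"])
      finally show ?thesis .
    qed
    have "diff_class M a b \<in> carrier ?Q" using ab by (auto simp: diff_group_carrier)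
    then have "h (diff_class M a b) = (THE z. \<exists>c \<in> carrier M. \<exists>d \<in> carrier M.
        diff_class M a b = diff_class M c d \<and> z = f c \<otimes>\<^bsub>G\<^esub> inv\<^bsub>G\<^esub> f d)"
      by (simp add: h_def)
    also have "\<dots> = f a \<otimes>\<^bsub>G\<^esub> inv\<^bsub>G\<^esub> f b"
    proof (rule the_equality)
      show "\<exists>c \<in> carrier M. \<exists>d \<in> carrier M. diff_class M a b = diff_class M c d \<and>
          f a \<otimes>\<^bsub>G\<^esub> inv\<^bsub>G\<^esub> f b = f c \<otimes>\<^bsub>G\<^esub> inv\<^bsub>G\<^esub> f d"
        using ab by blast
    qed (use * in blast)
    finally show ?thesis .
  qed
  have hc: "h \<in> carrier ?Q \<rightarrow>\<^sub>E carrier G"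
  proof (rule PiE_I)
    fix X assume "X \<in> carrier ?Q"
    then show "h X \<in> carrier G" by (auto simp: diff_group_carrier h)
  qed (simp add: h_def)
  show "\<exists>!h. h \<in> carrier ?Q \<rightarrow>\<^sub>E carrier G \<and> monoid_hom ?Q G h \<and>
      (\<forall>x \<in> carrier M. h (diff_map M x) = f x)"
  proof (rule ex1I[of _ h], intro conjI)
    show "h \<in> carrier ?Q \<rightarrow>\<^sub>E carrier G" by (rule hc)
    show "monoid_hom ?Q G h"
    proof -
      have "h (X \<otimes>\<^bsub>?Q\<^esub> Y) = h X \<otimes>\<^bsub>G\<^esub> h Y" if "X \<in> carrier ?Q" "Y \<in> carrier ?Q" for X Y
        using that
        by (auto simp: diff_group_carrier h diff_group_mult[OF assms] fm G.inv_mult G.m_ac)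
      then show ?thesis
        using hc
        by (auto simp: monoid_hom_def hom_def diff_group_one h)
    qed
    show "\<forall>x \<in> carrier M. h (diff_map M x) = f x" by (simp add: h)
  next
    fix k assume k: "k \<in> carrier ?Q \<rightarrow>\<^sub>E carrier G \<and> monoid_hom ?Q G k \<and>
      (\<forall>x \<in> carrier M. k (diff_map M x) = f x)"
    have "k X = h X" if "X \<in> carrier ?Q" for X
    proof -
      from that obtain a b where ab: "a \<in> carrier M" "b \<in> carrier M" and X: "X = diff_class M a b"
        unfolding diff_group_carrier by blast
      have "X \<otimes>\<^bsub>?Q\<^esub> diff_map M b = diff_map M a"
        using ab assms unfolding X by (auto simp: diff_group_mult diff_class_eq_iff m_ac)
      moreover have "k (X \<otimes>\<^bsub>?Q\<^esub> diff_map M b) = k X \<otimes>\<^bsub>G\<^esub> k (diff_map M b)"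
      proof -
        have "diff_map M b \<in> carrier ?Q" using ab by (auto simp: diff_group_carrier)
        then show ?thesis using k that by (auto simp: monoid_hom_def hom_def)
      qed
      ultimately have "k X \<otimes>\<^bsub>G\<^esub> f b = f a" using k ab by simp
      moreover have "k X \<in> carrier G" using k that by auto
      ultimately show "k X = h X"
        using ab unfolding X by (metis G.inv_solve_right fc h)
    qed
    then show "k = h"
      using k hc by (blast intro: PiE_ext)
  qed
qed

lemma grothendieck_group_exists:
  "comm_monoid M \<Longrightarrow> grothendieck_group M (diff_group M) (diff_map M)"
  by (simp add: grothendieck_group_def diff_group_universal)

lemma monoid_hom_compose:
  assumes "monoid A" "monoid_hom A B f" "monoid_hom B C g"
  shows "monoid_hom A C (compose (carrier A) g f)"
proof -
  interpret monoid A by fact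
  show ?thesis
    using assms(2,3) by (auto simp: monoid_hom_def hom_def compose_def Pi_iff)
qed

lemma grothendieck_group_universal:
  fixes M :: "'m monoid" and H :: "'h monoid"
  assumes "comm_monoid M" "grothendieck_group M H \<phi>"
  shows "universal_group TYPE('g) M H \<phi>"
proof -
  interpret comm_monoid M by fact
  let ?Q = "diff_group M" and ?\<pi> = "diff_map M"
  have uH: "universal_group TYPE('h) M H \<phi>" and uQ: "universal_group TYPE(('m \<times> 'm) set) M H \<phi>"
    using assms(2) by (auto simp: grothendieck_group_def)
  have H: "comm_group H" and \<phi>: "monoid_hom M H \<phi>"
    using uH by (auto simp: universal_group_def)
  have Q: "comm_group ?Q" and \<pi>: "monoid_hom M ?Q ?\<pi>"
    using assms(1) by (rule diff_group_comm_group, rule diff_map_hom)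
  interpret H: comm_group H by fact
  interpret Q: comm_group ?Q by fact
  have \<phi>c: "\<phi> x \<in> carrier H" and \<pi>c: "?\<pi> x \<in> carrier ?Q" if "x \<in> carrier M" for x
    using \<phi> \<pi> that by (auto simp: monoid_hom_def hom_def)
  obtain u where u: "u \<in> carrier H \<rightarrow>\<^sub>E carrier ?Q" "monoid_hom H ?Q u"
      "\<forall>x \<in> carrier M. u (\<phi> x) = ?\<pi> x"
    using uQ Q \<pi> unfolding universal_group_def by blast
  obtain v where v: "v \<in> carrier ?Q \<rightarrow>\<^sub>E carrier H" "monoid_hom ?Q H v"
      "\<forall>x \<in> carrier M. v (?\<pi> x) = \<phi> x"
    using diff_group_universal[OF assms(1), where 'g = 'h] H \<phi> unfolding universal_group_def
    by blast
  have ex1: "\<exists>!h. h \<in> carrier H \<rightarrow>\<^sub>E carrier H \<and> monoid_hom H H h \<and> (\<forall>x \<in> carrier M. h (\<phi> x) = \<phi> x)"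
    using uH H \<phi> unfolding universal_group_def by blast
  have "compose (carrier H) v u = (\<lambda>x \<in> carrier H. x)"
  proof (rule ex1E[OF ex1], elim conjE)
    fix k assume k: "\<forall>h. h \<in> carrier H \<rightarrow>\<^sub>E carrier H \<and> monoid_hom H H h \<and>
      (\<forall>x \<in> carrier M. h (\<phi> x) = \<phi> x) \<longrightarrow> h = k"
    have "compose (carrier H) v u \<in> carrier H \<rightarrow>\<^sub>E carrier H"
      using u v by (auto simp: compose_def)
    then have "compose (carrier H) v u = k"
      using monoid_hom_compose[OF H.monoid_axioms u(2) v(2)] u v \<phi>c
      by (intro k[rule_format]) (auto simp: compose_eq)
    moreover have "(\<lambda>x \<in> carrier H. x) = k"
      using \<phi>c by (intro k[rule_format]) (auto simp: monoid_hom_def hom_def)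
    ultimately show ?thesis by simp
  qed
  then have vu: "v (u x) = x" if "x \<in> carrier H" for x
    using that by (metis compose_eq restrict_apply')
  show ?thesis
    unfolding universal_group_def
  proof (intro conjI allI impI)
    fix G :: "'g monoid" and f assume G: "comm_group G" and f: "monoid_hom M G f"
    have ex1: "\<exists>!h. h \<in> carrier ?Q \<rightarrow>\<^sub>E carrier G \<and> monoid_hom ?Q G h \<and>
        (\<forall>x \<in> carrier M. h (?\<pi> x) = f x)"
      using diff_group_universal[OF assms(1), where 'g = 'g] G f unfolding universal_group_def
      by blast
    then obtain w where w: "w \<in> carrier ?Q \<rightarrow>\<^sub>E carrier G" "monoid_hom ?Q G w"
        "\<forall>x \<in> carrier M. w (?\<pi> x) = f x"
      by blast
    show "\<exists>!h. h \<in> carrier H \<rightarrow>\<^sub>E carrier G \<and> monoid_hom H G h \<and> (\<forall>x \<in> carrier M. h (\<phi> x) = f x)"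
    proof (rule ex1I[of _ "compose (carrier H) w u"])
      show "compose (carrier H) w u \<in> carrier H \<rightarrow>\<^sub>E carrier G \<and>
          monoid_hom H G (compose (carrier H) w u) \<and>
          (\<forall>x \<in> carrier M. compose (carrier H) w u (\<phi> x) = f x)"
        using monoid_hom_compose[OF H.monoid_axioms u(2) w(2)] u w \<phi>c by (auto simp: compose_def)
    next
      fix h assume h: "h \<in> carrier H \<rightarrow>\<^sub>E carrier G \<and> monoid_hom H G h \<and>
        (\<forall>x \<in> carrier M. h (\<phi> x) = f x)"
      have "compose (carrier ?Q) h v \<in> carrier ?Q \<rightarrow>\<^sub>E carrier G \<and>
          monoid_hom ?Q G (compose (carrier ?Q) h v) \<and>
          (\<forall>x \<in> carrier M. compose (carrier ?Q) h v (?\<pi> x) = f x)"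
        using monoid_hom_compose[OF Q.monoid_axioms v(2)] h v \<pi>c by (auto simp: compose_def)
      with ex1 w have eq: "compose (carrier ?Q) h v = w" by blast
      show "h = compose (carrier H) w u"
      proof (rule ext)
        fix x
        show "h x = compose (carrier H) w u x"
        proof (cases "x \<in> carrier H")
          case True
          then have "u x \<in> carrier ?Q" using u by auto
          then have "w (u x) = h (v (u x))" using eq by (metis compose_eq)
          then show ?thesis using True by (simp add: compose_eq vu)
        next
          case False
          then show ?thesis using h by (auto simp: compose_def PiE_def extensional_def)
        qed
      qed
    qed
  qed (fact H \<phi>)+
qed

end

theory Submission
  imports Defs
begin

text \<open>
  Every element of the Grothendieck group is a difference $\varphi a - \varphi c$, and
  $\varphi a = \varphi b$ holds exactly if $a + e = b + e$ for some $e$. Finitely many elements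
  have a common subtrahend, and
  \[ (\varphi a - \varphi c) \wedge (\varphi b - \varphi c) = \varphi (a \wedge b) - \varphi c \]
  is forced by translation invariance. It is independent of the representation since $+$
  distributes over $\wedge$, and it inherits the laws of a meet-monoid from $M$.
  In a group, inversion reverses the order of any such structure, so that joins exist and are
  preserved by all morphisms of meet-monoids.
\<close>

section \<open>Meets on groups\<close>

text \<open>This is \<open>lattice_ordered_group\<close> without the lattice axiom and without
  distributivity over joins. Both are derived below, so a meet-monoid structure on a commutative
  group is already a lattice-ordered group.\<close>

locale meet_group = comm_group G + meet_monoid G wedge
  for G (structure) and wedge (infixl \<open>\<curlywedge>\<close> 75)
begin

lemma wedge_mult_distrib:
  assumes "x \<in> carrier G" "y \<in> carrier G" "z \<in> carrier G"
  shows "(y \<curlywedge> z) \<otimes> x = (y \<otimes> x) \<curlywedge> (z \<otimes> x)"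
  using assms mult_wedge_distrib[of x y z] by (simp add: m_comm wedge_closed)

abbreviation below (infix \<open>\<preceq>\<close> 50) where "x \<preceq> y \<equiv> x \<curlywedge> y = x"

lemma below_refl: "x \<in> carrier G \<Longrightarrow> x \<preceq> x"
  by (rule wedge_idem)

lemma below_antisym: "\<lbrakk>x \<preceq> y; y \<preceq> x; x \<in> carrier G; y \<in> carrier G\<rbrakk> \<Longrightarrow> x = y"
  using wedge_comm[of x y] by simp

lemma below_trans:
  "\<lbrakk>x \<preceq> y; y \<preceq> z; x \<in> carrier G; y \<in> carrier G; z \<in> carrier G\<rbrakk> \<Longrightarrow> x \<preceq> z"
  using wedge_assoc[of x y z] by simp

lemma wedge_below_left: "\<lbrakk>x \<in> carrier G; y \<in> carrier G\<rbrakk> \<Longrightarrow> x \<curlywedge> y \<preceq> x"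
  by (metis wedge_assoc wedge_closed wedge_comm wedge_idem)

lemma wedge_below_right: "\<lbrakk>x \<in> carrier G; y \<in> carrier G\<rbrakk> \<Longrightarrow> x \<curlywedge> y \<preceq> y"
  by (metis wedge_assoc wedge_idem)

lemma below_wedge:
  "\<lbrakk>z \<preceq> x; z \<preceq> y; x \<in> carrier G; y \<in> carrier G; z \<in> carrier G\<rbrakk> \<Longrightarrow> z \<preceq> x \<curlywedge> y"
  using wedge_assoc[of z x y] by simp

lemma mult_below_iff:
  assumes "x \<in> carrier G" "y \<in> carrier G" "z \<in> carrier G"
  shows "z \<otimes> x \<preceq> z \<otimes> y \<longleftrightarrow> x \<preceq> y"
  using assms by (simp add: wedge_closed flip: mult_wedge_distrib)

text \<open>Translation by \<open>x \<otimes> y\<close> carries \<open>inv y\<close> to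
  \<open>x\<close> and \<open>inv x\<close> to \<open>y\<close>, and translations preserve and
  reflect the order.\<close>

lemma inv_below_iff:
  assumes "x \<in> carrier G" "y \<in> carrier G"
  shows "inv y \<preceq> inv x \<longleftrightarrow> x \<preceq> y"
proof -
  have "x \<otimes> y \<otimes> inv y = x" "x \<otimes> y \<otimes> inv x = y"
    using assms by (simp add: m_assoc) (metis assms m_assoc m_comm m_closed inv_closed r_inv r_one)
  then show ?thesis
    using mult_below_iff[of "inv y" "inv x" "x \<otimes> y"] assms by simp
qed

text \<open>Inversion is an order-reversing involution, so it turns the meet of the inverses into a
  join.\<close>

lemma inv_wedge_inv_least:
  assumes x: "x \<in> carrier G" and y: "y \<in> carrier G"
  shows "least (meet_order G (\<curlywedge>)) (inv (inv x \<curlywedge> inv y)) (Upper (meet_order G (\<curlywedge>)) {x, y})"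
proof -
  let ?m = "inv x \<curlywedge> inv y"
  have m: "?m \<in> carrier G"
    using x y by (simp add: wedge_closed)
  have "x \<preceq> inv ?m" "y \<preceq> inv ?m"
    using x y m inv_below_iff[of x "inv ?m"] inv_below_iff[of y "inv ?m"]
    by (simp_all add: wedge_below_left wedge_below_right)
  moreover have "inv ?m \<preceq> z" if "x \<preceq> z" "y \<preceq> z" "z \<in> carrier G" for z
  proof -
    have "inv z \<preceq> ?m"
      using that x y by (intro below_wedge) (simp_all add: inv_below_iff)
    then show ?thesis
      using that m inv_below_iff[of "inv ?m" z] by simp
  qed
  ultimately show ?thesis
    using x y m by (auto simp: least_def Upper_def meet_order_def)
qed

lemma wedge_greatest:
  assumes "x \<in> carrier G" "y \<in> carrier G"
  shows "greatest (meet_order G (\<curlywedge>)) (x \<curlywedge> y) (Lower (meet_order G (\<curlywedge>)) {x, y})"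
  using assms
  by (auto simp: greatest_def Lower_def meet_order_def wedge_closed wedge_below_left
      wedge_below_right below_wedge)

lemma partial_order_meet_order: "partial_order (meet_order G (\<curlywedge>))"
proof unfold_locales
  fix x y z
  assume "x \<sqsubseteq>\<^bsub>meet_order G (\<curlywedge>)\<^esub> y" "y \<sqsubseteq>\<^bsub>meet_order G (\<curlywedge>)\<^esub> z"
    "x \<in> carrier (meet_order G (\<curlywedge>))" "y \<in> carrier (meet_order G (\<curlywedge>))"
    "z \<in> carrier (meet_order G (\<curlywedge>))"
  then show "x \<sqsubseteq>\<^bsub>meet_order G (\<curlywedge>)\<^esub> z"
    using below_trans[of x y z] by (simp add: meet_order_def)
qed (auto simp: meet_order_def below_refl intro: below_antisym)

lemma lattice_meet_order: "lattice (meet_order G (\<curlywedge>))"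
proof -
  interpret partial_order "meet_order G (\<curlywedge>)" by (rule partial_order_meet_order)
  have "carrier (meet_order G (\<curlywedge>)) = carrier G"
    by (simp add: meet_order_def)
  then show ?thesis
    by unfold_locales (use inv_wedge_inv_least wedge_greatest in blast)+
qed

text \<open>Least upper bounds are unique in a partial order, so the explicit one found above is the
  join.\<close>

lemma join_eq:
  assumes "x \<in> carrier G" "y \<in> carrier G"
  shows "x \<squnion>\<^bsub>meet_order G (\<curlywedge>)\<^esub> y = inv (inv x \<curlywedge> inv y)"
proof -
  interpret partial_order "meet_order G (\<curlywedge>)" by (rule partial_order_meet_order)
  show ?thesis
    unfolding join_def sup_def
    using inv_wedge_inv_least[OF assms] by (blast intro: least_unique)
qed

lemma lattice_ordered_group: "lattice_ordered_group G (\<curlywedge>)"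
proof -
  \<comment> \<open>Pulled inside the outer inverse, \<open>x\<close> becomes \<open>inv x\<close>,
    and there distributivity over the meet applies.\<close>
  have "x \<otimes> inv (inv y \<curlywedge> inv z) = inv (inv (x \<otimes> y) \<curlywedge> inv (x \<otimes> z))"
    if "x \<in> carrier G" "y \<in> carrier G" "z \<in> carrier G" for x y z
    using that inv_mult[of "inv x" "inv y \<curlywedge> inv z"]
    by (simp add: inv_mult mult_wedge_distrib wedge_closed)
  then show ?thesis
    using comm_group_axioms meet_monoid_axioms
    by (simp add: lattice_ordered_group_def lattice_ordered_group_axioms_def lattice_meet_order
        join_eq)
qed

end

section \<open>Morphisms between groups with a meet\<close>

lemma monoid_hom_inv:
  assumes "group G" "group N" "monoid_hom G N f" "x \<in> carrier G"
  shows "f (inv\<^bsub>G\<^esub> x) = inv\<^bsub>N\<^esub> f x"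
proof -
  interpret group_hom G N f
    using assms by (simp add: group_hom_def group_hom_axioms_def monoid_hom_def)
  show ?thesis using assms(4) by simp
qed

text \<open>Between groups, a monoid morphism commutes with inversion. As joins are built from
  inversion and meet, preserving meets is enough.\<close>

lemma lattice_ordered_group_hom_iff:
  assumes "meet_group G wG" "meet_group N wN"
  shows "lattice_ordered_group_hom G wG N wN f \<longleftrightarrow> meet_monoid_hom G wG N wN f"
proof
  interpret G: meet_group G wG by fact
  interpret N: meet_group N wN by fact
  assume f: "meet_monoid_hom G wG N wN f"
  then have "f x \<in> carrier N" "f (inv\<^bsub>G\<^esub> x) = inv\<^bsub>N\<^esub> f x" if "x \<in> carrier G" for x
    using that monoid_hom_inv[OF G.group_axioms N.group_axioms]
    by (auto simp: meet_monoid_hom_def monoid_hom_def hom_def)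
  with f show "lattice_ordered_group_hom G wG N wN f"
    by (simp add: lattice_ordered_group_hom_def G.join_eq N.join_eq G.wedge_closed)
      (simp add: meet_monoid_hom_def)
qed (simp add: lattice_ordered_group_hom_def)

section \<open>The Grothendieck group as a group of differences\<close>

text \<open>The universal property, tested against \<open>diff_group M\<close>, makes
  \<open>diff_map M\<close> factor through \<open>\<phi>\<close>. Hence \<open>\<phi>\<close>
  identifies no more than \<open>diff_map M\<close> does, and \<open>diff_class_eq_iff\<close>
  describes what that is. Conversely, \<open>\<phi> e\<close> can be cancelled in
  \<open>H\<close>.\<close>

lemma grothendieck_group_eq_iff:
  fixes M :: "'m monoid" and H :: "'h monoid"
  assumes "comm_monoid M" "grothendieck_group M H \<phi>" "a \<in> carrier M" "b \<in> carrier M"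
  shows "\<phi> a = \<phi> b \<longleftrightarrow> (\<exists>e \<in> carrier M. a \<otimes>\<^bsub>M\<^esub> e = b \<otimes>\<^bsub>M\<^esub> e)"
proof
  interpret comm_monoid M by fact
  have "universal_group TYPE(('m \<times> 'm) set) M H \<phi>"
    using assms(2) by (simp add: grothendieck_group_def)
  then obtain u where "\<forall>x \<in> carrier M. u (\<phi> x) = diff_map M x"
    using diff_group_comm_group[OF assms(1)] diff_map_hom[OF assms(1)]
    unfolding universal_group_def by blast
  moreover assume "\<phi> a = \<phi> b"
  ultimately have "diff_map M a = diff_map M b"
    using assms(3,4) by metis
  then show "\<exists>e \<in> carrier M. a \<otimes>\<^bsub>M\<^esub> e = b \<otimes>\<^bsub>M\<^esub> e"
    using assms by (simp add: diff_class_eq_iff)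
next
  assume "\<exists>e \<in> carrier M. a \<otimes>\<^bsub>M\<^esub> e = b \<otimes>\<^bsub>M\<^esub> e"
  then obtain e where e: "e \<in> carrier M" "a \<otimes>\<^bsub>M\<^esub> e = b \<otimes>\<^bsub>M\<^esub> e" ..
  have H: "comm_group H" and \<phi>: "monoid_hom M H \<phi>"
    using assms(2) by (auto simp: grothendieck_group_def universal_group_def)
  interpret H: comm_group H by fact
  have \<phi>c: "\<phi> x \<in> carrier H" if "x \<in> carrier M" for x
    using \<phi> that by (auto simp: monoid_hom_def hom_def)
  have \<phi>m: "\<phi> (x \<otimes>\<^bsub>M\<^esub> e) = \<phi> x \<otimes>\<^bsub>H\<^esub> \<phi> e" if "x \<in> carrier M" for x
    using \<phi> that e(1) by (simp add: monoid_hom_def hom_mult)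
  have "\<phi> a \<otimes>\<^bsub>H\<^esub> \<phi> e = \<phi> b \<otimes>\<^bsub>H\<^esub> \<phi> e"
    using e(2) \<phi>m[OF assms(3)] \<phi>m[OF assms(4)] by simp
  then show "\<phi> a = \<phi> b"
    using \<phi>c e(1) assms(3,4) by simp
qed

text \<open>In \<open>diff_group M\<close> every element is a difference by construction. The
  comparison maps \<open>u\<close> and \<open>v\<close> transport this to \<open>H\<close>, since
  \<open>v\<close> undoes \<open>u\<close>.\<close>

lemma grothendieck_group_diff:
  fixes M :: "'m monoid" and H :: "'h monoid"
  assumes "comm_monoid M" "grothendieck_group M H \<phi>" "x \<in> carrier H"
  shows "\<exists>a \<in> carrier M. \<exists>c \<in> carrier M. x = \<phi> a \<otimes>\<^bsub>H\<^esub> inv\<^bsub>H\<^esub> \<phi> c"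
proof -
  interpret comm_monoid M by fact
  let ?Q = "diff_group M" and ?\<pi> = "diff_map M"
  have H: "comm_group H" and \<phi>: "monoid_hom M H \<phi>"
    using assms(2) by (auto simp: grothendieck_group_def universal_group_def)
  interpret H: comm_group H by fact
  interpret Q: comm_group ?Q by (rule diff_group_comm_group[OF assms(1)])
  have \<phi>c: "\<phi> a \<in> carrier H" if "a \<in> carrier M" for a
    using \<phi> that by (auto simp: monoid_hom_def hom_def)
  obtain u where u: "u \<in> carrier H \<rightarrow>\<^sub>E carrier ?Q" "monoid_hom H ?Q u"
      "\<forall>a \<in> carrier M. u (\<phi> a) = ?\<pi> a"
    using grothendieck_group_universal[OF assms(1,2), where 'g = "('m \<times> 'm) set"]
      Q.comm_group_axioms diff_map_hom[OF assms(1)]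
    unfolding universal_group_def by blast
  obtain v where v: "v \<in> carrier ?Q \<rightarrow>\<^sub>E carrier H" "monoid_hom ?Q H v"
      "\<forall>a \<in> carrier M. v (?\<pi> a) = \<phi> a"
    using diff_group_universal[OF assms(1), where 'g = 'h] H \<phi> unfolding universal_group_def
    by blast
  have "\<exists>!h. h \<in> carrier H \<rightarrow>\<^sub>E carrier H \<and> monoid_hom H H h \<and> (\<forall>a \<in> carrier M. h (\<phi> a) = \<phi> a)"
    using grothendieck_group_universal[OF assms(1,2), where 'g = 'h] H \<phi>
    unfolding universal_group_def by blast
  \<comment> \<open>Both \<open>v \<circ> u\<close> and the identity extend \<open>\<phi>\<close>
    along itself; uniqueness identifies them once both are restricted to the carrier.\<close>
  moreover have "compose (carrier H) v u \<in> carrier H \<rightarrow>\<^sub>E carrier H \<and>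
      monoid_hom H H (compose (carrier H) v u) \<and>
      (\<forall>a \<in> carrier M. compose (carrier H) v u (\<phi> a) = \<phi> a)"
    using monoid_hom_compose[OF H.monoid_axioms u(2) v(2)] u v \<phi>c by (auto simp: compose_def)
  moreover have "(\<lambda>x \<in> carrier H. x) \<in> carrier H \<rightarrow>\<^sub>E carrier H \<and>
      monoid_hom H H (\<lambda>x \<in> carrier H. x) \<and> (\<forall>a \<in> carrier M. (\<lambda>x \<in> carrier H. x) (\<phi> a) = \<phi> a)"
    using \<phi>c by (auto simp: monoid_hom_def hom_def)
  ultimately have "compose (carrier H) v u = (\<lambda>x \<in> carrier H. x)"
    by blast
  then have vu: "v (u x) = x"
    using assms(3) by (metis compose_eq restrict_apply')
  obtain a c where ac: "a \<in> carrier M" "c \<in> carrier M" and ux: "u x = diff_class M a c"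
    using u(1) assms(3) diff_group_carrier by (metis PiE_mem)
  \<comment> \<open>Clearing the subtrahend gives an equation without inverses, to which
    \<open>v\<close> can be applied using multiplicativity alone.\<close>
  have "u x \<otimes>\<^bsub>?Q\<^esub> ?\<pi> c = ?\<pi> a"
    using ac assms(1) unfolding ux by (auto simp: diff_group_mult diff_class_eq_iff m_ac)
  moreover have "v (u x \<otimes>\<^bsub>?Q\<^esub> ?\<pi> c) = v (u x) \<otimes>\<^bsub>H\<^esub> v (?\<pi> c)"
    using v(2) ac ux unfolding monoid_hom_def by (intro hom_mult) (auto simp: diff_group_carrier)
  ultimately have "\<phi> a = x \<otimes>\<^bsub>H\<^esub> \<phi> c"
    using vu v(3) ac by simp
  then show ?thesis
    using ac \<phi>c assms(3) by (metis H.inv_solve_right)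
qed

section \<open>Calculation with differences in the Grothendieck group of a meet-monoid\<close>

locale grothendieck_meet = M: meet_monoid M wM + H: comm_group H
  for M :: "'m monoid" (structure) and wM (infixl \<open>\<curlywedge>\<close> 75) and H :: "'h monoid" +
  fixes \<phi> :: "'m \<Rightarrow> 'h"
  assumes groth: "grothendieck_group M H \<phi>"
begin

lemma phi_hom: "monoid_hom M H \<phi>"
  using groth by (simp add: grothendieck_group_def universal_group_def)

lemma phi_closed [simp]: "a \<in> carrier M \<Longrightarrow> \<phi> a \<in> carrier H"
  using phi_hom by (auto simp: monoid_hom_def hom_def)

lemma phi_mult [simp]:
  "\<lbrakk>a \<in> carrier M; b \<in> carrier M\<rbrakk> \<Longrightarrow> \<phi> (a \<otimes> b) = \<phi> a \<otimes>\<^bsub>H\<^esub> \<phi> b"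
  using phi_hom by (auto simp: monoid_hom_def hom_def)

lemma phi_one [simp]: "\<phi> \<one> = \<one>\<^bsub>H\<^esub>"
  using phi_hom by (simp add: monoid_hom_def)

lemmas phi_eq_iff = grothendieck_group_eq_iff[OF M.comm_monoid_axioms groth]

definition diff where "diff a c = \<phi> a \<otimes>\<^bsub>H\<^esub> inv\<^bsub>H\<^esub> \<phi> c"

lemma diff_closed [simp]: "\<lbrakk>a \<in> carrier M; c \<in> carrier M\<rbrakk> \<Longrightarrow> diff a c \<in> carrier H"
  by (simp add: diff_def)

lemma diff_one: "a \<in> carrier M \<Longrightarrow> diff a \<one> = \<phi> a"
  by (simp add: diff_def)

lemma diff_mult:
  "\<lbrakk>a \<in> carrier M; b \<in> carrier M; c \<in> carrier M; d \<in> carrier M\<rbrakk>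
    \<Longrightarrow> diff a c \<otimes>\<^bsub>H\<^esub> diff b d = diff (a \<otimes> b) (c \<otimes> d)"
  by (simp add: diff_def H.inv_mult H.m_ac)

lemma diff_expand:
  "\<lbrakk>a \<in> carrier M; c \<in> carrier M; d \<in> carrier M\<rbrakk> \<Longrightarrow> diff (a \<otimes> d) (c \<otimes> d) = diff a c"
  by (subst diff_mult[symmetric]) (simp_all add: diff_def)

text \<open>Multiplication by \<open>\<phi> (c \<otimes> d)\<close> clears both subtrahends and
  leaves an equation between values of \<open>\<phi>\<close>, which \<open>phi_eq_iff\<close>
  decides.\<close>

lemma diff_eq_iff:
  assumes "a \<in> carrier M" "b \<in> carrier M" "c \<in> carrier M" "d \<in> carrier M"
  shows "diff a c = diff b d \<longleftrightarrow> (\<exists>e \<in> carrier M. a \<otimes> d \<otimes> e = b \<otimes> c \<otimes> e)"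
proof -
  have cancel: "diff x z \<otimes>\<^bsub>H\<^esub> \<phi> (z \<otimes> y) = \<phi> (x \<otimes> y)"
    if "x \<in> carrier M" "y \<in> carrier M" "z \<in> carrier M" for x y z
    using that diff_mult[of x "z \<otimes> y" z \<one>] diff_expand[of "x \<otimes> y" \<one> z]
    by (simp add: diff_one M.m_ac del: phi_mult)
  have "diff a c \<otimes>\<^bsub>H\<^esub> \<phi> (c \<otimes> d) = \<phi> (a \<otimes> d)" "diff b d \<otimes>\<^bsub>H\<^esub> \<phi> (c \<otimes> d) = \<phi> (b \<otimes> c)"
    using assms cancel[of a d c] cancel[of b c d] by (simp_all only: M.m_comm[of c d])
  then have "diff a c = diff b d \<longleftrightarrow> \<phi> (a \<otimes> d) = \<phi> (b \<otimes> c)"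
    using assms by (metis H.right_cancel M.m_closed diff_closed phi_closed)
  then show ?thesis
    using assms by (simp add: phi_eq_iff del: phi_mult)
qed

lemma diff_cases:
  assumes "x \<in> carrier H"
  obtains a c where "a \<in> carrier M" "c \<in> carrier M" "x = diff a c"
  using grothendieck_group_diff[OF M.comm_monoid_axioms groth assms] unfolding diff_def by blast

text \<open>Two differences with subtrahends \<open>c\<close> and \<open>d\<close> are both expanded
  to the subtrahend \<open>c \<otimes> d\<close>.\<close>

lemma diff_cases2:
  assumes "x \<in> carrier H" "y \<in> carrier H"
  obtains a b c where "a \<in> carrier M" "b \<in> carrier M" "c \<in> carrier M" "x = diff a c" "y = diff b c"
proof -
  obtain a c where ac: "a \<in> carrier M" "c \<in> carrier M" "x = diff a c"
    using diff_cases[OF assms(1)] .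
  obtain b d where bd: "b \<in> carrier M" "d \<in> carrier M" "y = diff b d"
    using diff_cases[OF assms(2)] .
  show thesis
    using that[of "a \<otimes> d" "b \<otimes> c" "c \<otimes> d"] ac bd diff_expand[of a c d] diff_expand[of b d c]
    by (simp add: M.m_comm)
qed

lemma diff_cases3:
  assumes "x \<in> carrier H" "y \<in> carrier H" "z \<in> carrier H"
  obtains a b e c where "a \<in> carrier M" "b \<in> carrier M" "e \<in> carrier M" "c \<in> carrier M"
    "x = diff a c" "y = diff b c" "z = diff e c"
proof -
  obtain a b c where abc: "a \<in> carrier M" "b \<in> carrier M" "c \<in> carrier M"
      "x = diff a c" "y = diff b c"
    using diff_cases2[OF assms(1,2)] .
  obtain e d where ed: "e \<in> carrier M" "d \<in> carrier M" "z = diff e d"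
    using diff_cases[OF assms(3)] .
  show thesis
    using that[of "a \<otimes> d" "b \<otimes> d" "e \<otimes> c" "c \<otimes> d"] abc ed
      diff_expand[of a c d] diff_expand[of b c d] diff_expand[of e d c]
    by (simp add: M.m_comm)
qed

section \<open>The induced meet on the Grothendieck group: independence of representatives,
  construction and laws\<close>

lemma diff_wedge_cong:
  assumes M: "a \<in> carrier M" "b \<in> carrier M" "c \<in> carrier M"
      "a' \<in> carrier M" "b' \<in> carrier M" "c' \<in> carrier M"
    and "diff a c = diff a' c'" "diff b c = diff b' c'"
  shows "diff (a \<curlywedge> b) c = diff (a' \<curlywedge> b') c'"
proof -
  obtain e k where e: "e \<in> carrier M" "a \<otimes> c' \<otimes> e = a' \<otimes> c \<otimes> e"
    and k: "k \<in> carrier M" "b \<otimes> c' \<otimes> k = b' \<otimes> c \<otimes> k"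
    using assms by (auto simp: diff_eq_iff)
  have wedge_mult: "(x \<curlywedge> y) \<otimes> z = (z \<otimes> x) \<curlywedge> (z \<otimes> y)"
    if "x \<in> carrier M" "y \<in> carrier M" "z \<in> carrier M" for x y z
    using that by (metis M.m_comm M.mult_wedge_distrib M.wedge_closed)
  \<comment> \<open>The product \<open>e \<otimes> k\<close> serves as a common witness: the first
    equation is multiplied by \<open>k\<close>, the second by \<open>e\<close>. Both then have the
    same factors in front, so distributivity combines them into one equation between meets.\<close>
  have "(c' \<otimes> (e \<otimes> k)) \<otimes> a = (a \<otimes> c' \<otimes> e) \<otimes> k"
    using M e(1) k(1) by (simp add: M.m_ac)
  also have "\<dots> = (c \<otimes> (e \<otimes> k)) \<otimes> a'"
    unfolding e(2) using M e(1) k(1) by (simp add: M.m_ac)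
  finally have 1: "(c' \<otimes> (e \<otimes> k)) \<otimes> a = (c \<otimes> (e \<otimes> k)) \<otimes> a'" .
  have "(c' \<otimes> (e \<otimes> k)) \<otimes> b = (b \<otimes> c' \<otimes> k) \<otimes> e"
    using M e(1) k(1) by (simp add: M.m_ac)
  also have "\<dots> = (c \<otimes> (e \<otimes> k)) \<otimes> b'"
    unfolding k(2) using M e(1) k(1) by (simp add: M.m_ac)
  finally have 2: "(c' \<otimes> (e \<otimes> k)) \<otimes> b = (c \<otimes> (e \<otimes> k)) \<otimes> b'" .
  have "(a \<curlywedge> b) \<otimes> c' \<otimes> (e \<otimes> k) = (a \<curlywedge> b) \<otimes> (c' \<otimes> (e \<otimes> k))"
    using M e(1) k(1) by (simp add: M.m_assoc M.wedge_closed)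
  also have "\<dots> = (a' \<curlywedge> b') \<otimes> (c \<otimes> (e \<otimes> k))"
    using M e(1) k(1) 1 2 by (simp only: wedge_mult M.m_closed)
  also have "\<dots> = (a' \<curlywedge> b') \<otimes> c \<otimes> (e \<otimes> k)"
    using M e(1) k(1) by (simp add: M.m_assoc M.wedge_closed)
  finally show ?thesis
    using M e(1) k(1) by (subst diff_eq_iff) (auto simp: M.wedge_closed)
qed

text \<open>The description admits every representation with a common subtrahend;
  \<open>diff_wedge_cong\<close> makes its value unique. The restriction in both arguments places
  \<open>wH\<close> in the extensional function space demanded by
  \<open>compatible_meet\<close>.\<close>

definition wH where
  "wH = (\<lambda>x \<in> carrier H. \<lambda>y \<in> carrier H. THE z. \<exists>a \<in> carrier M. \<exists>b \<in> carrier M. \<exists>c \<in> carrier M.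
     x = diff a c \<and> y = diff b c \<and> z = diff (a \<curlywedge> b) c)"

lemma wH_diff:
  assumes "a \<in> carrier M" "b \<in> carrier M" "c \<in> carrier M"
  shows "wH (diff a c) (diff b c) = diff (a \<curlywedge> b) c"
proof -
  have "wH (diff a c) (diff b c) = (THE z. \<exists>a' \<in> carrier M. \<exists>b' \<in> carrier M. \<exists>c' \<in> carrier M.
     diff a c = diff a' c' \<and> diff b c = diff b' c' \<and> z = diff (a' \<curlywedge> b') c')"
    using assms by (simp add: wH_def)
  also have "\<dots> = diff (a \<curlywedge> b) c"
  proof (rule the_equality)
    fix z assume "\<exists>a' \<in> carrier M. \<exists>b' \<in> carrier M. \<exists>c' \<in> carrier M.
      diff a c = diff a' c' \<and> diff b c = diff b' c' \<and> z = diff (a' \<curlywedge> b') c'"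
    then show "z = diff (a \<curlywedge> b) c"
      using diff_wedge_cong assms by metis
  qed (use assms in blast)
  finally show ?thesis .
qed

text \<open>Over a common subtrahend, the laws of the meet are those of \<open>M\<close> applied to
  the minuends. For distributivity both sides have subtrahend \<open>c \<otimes> c\<close>.\<close>

lemma meet_monoid_wH: "meet_monoid H wH"
proof unfold_locales
  fix x y assume xy: "x \<in> carrier H" "y \<in> carrier H"
  then obtain a b c where abc: "a \<in> carrier M" "b \<in> carrier M" "c \<in> carrier M"
      "x = diff a c" "y = diff b c"
    by (rule diff_cases2)
  then show "wH x y \<in> carrier H" "wH x y = wH y x" "wH x x = x"
    by (simp_all add: wH_diff M.wedge_closed M.wedge_idem M.wedge_comm)
next
  fix x y z assume xyz: "x \<in> carrier H" "y \<in> carrier H" "z \<in> carrier H"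
  then obtain a b e c where abec: "a \<in> carrier M" "b \<in> carrier M" "e \<in> carrier M"
      "c \<in> carrier M" "x = diff a c" "y = diff b c" "z = diff e c"
    by (rule diff_cases3)
  then show "wH (wH x y) z = wH x (wH y z)"
    by (simp add: wH_diff M.wedge_closed M.wedge_assoc)
  show "x \<otimes>\<^bsub>H\<^esub> wH y z = wH (x \<otimes>\<^bsub>H\<^esub> y) (x \<otimes>\<^bsub>H\<^esub> z)"
    using abec by (simp add: wH_diff diff_mult M.wedge_closed M.mult_wedge_distrib)
qed

lemma compatible_meet_wH: "compatible_meet M (\<curlywedge>) H \<phi> wH"
proof -
  interpret W: meet_monoid H wH by (rule meet_monoid_wH)
  have "wH \<in> carrier H \<rightarrow>\<^sub>E (carrier H \<rightarrow>\<^sub>E carrier H)"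
  proof (intro PiE_I)
    show "wH x y = undefined" if "x \<in> carrier H" "y \<notin> carrier H" for x y
      using that by (simp add: wH_def)
    show "wH x = undefined" if "x \<notin> carrier H" for x
      using that by (simp add: wH_def)
  qed (rule W.wedge_closed)
  \<comment> \<open>Values of \<open>\<phi>\<close> are the differences with subtrahend
    \<open>\<one>\<close>.\<close>
  moreover have "\<phi> (a \<curlywedge> b) = wH (\<phi> a) (\<phi> b)" if "a \<in> carrier M" "b \<in> carrier M" for a b
    using that wH_diff[of a b \<one>] by (simp add: diff_one M.wedge_closed)
  ultimately show ?thesis
    using meet_monoid_wH phi_hom by (simp add: compatible_meet_def meet_monoid_hom_def)
qed

section \<open>Uniqueness of the meet and the universal property\<close>

lemma meet_monoid_hom_diff:
  assumes "meet_group G wG" "meet_monoid_hom M (\<curlywedge>) G wG f" "monoid_hom H G h"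
    and h: "\<And>x. x \<in> carrier M \<Longrightarrow> h (\<phi> x) = f x"
    and M: "a \<in> carrier M" "b \<in> carrier M" "c \<in> carrier M"
  shows "h (diff (a \<curlywedge> b) c) = wG (h (diff a c)) (h (diff b c))"
proof -
  interpret G: meet_group G wG by fact
  have f: "f x \<in> carrier G" if "x \<in> carrier M" for x
    using assms(2) that by (auto simp: meet_monoid_hom_def monoid_hom_def hom_def)
  have hd: "h (diff x c) = f x \<otimes>\<^bsub>G\<^esub> inv\<^bsub>G\<^esub> f c" if "x \<in> carrier M" for x
    using that M(3) assms(3) monoid_hom_inv[OF H.group_axioms G.group_axioms assms(3)]
    by (simp add: diff_def h monoid_hom_def hom_def)
  \<comment> \<open>By \<open>hd\<close>, all three values of \<open>h\<close> are translates by the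
    inverse of \<open>f c\<close>, and this translation distributes over \<open>wG\<close>.\<close>
  show ?thesis
    using M f assms(2) by (simp add: hd M.wedge_closed G.wedge_mult_distrib meet_monoid_hom_def)
qed

text \<open>Apply \<open>meet_monoid_hom_diff\<close> to the identity of \<open>H\<close>, which
  extends \<open>\<phi>\<close> into \<open>H\<close> with the meet \<open>w\<close>. The value on
  differences is thus forced.\<close>

lemma compatible_meet_diff:
  assumes "compatible_meet M (\<curlywedge>) H \<phi> w" "a \<in> carrier M" "b \<in> carrier M" "c \<in> carrier M"
  shows "w (diff a c) (diff b c) = diff (a \<curlywedge> b) c"
proof -
  have "meet_group H w"
    using assms(1) H.comm_group_axioms by (simp add: compatible_meet_def meet_group_def)
  moreover have "monoid_hom H H (\<lambda>x. x)"
    by (simp add: monoid_hom_def hom_def)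
  ultimately show ?thesis
    using meet_monoid_hom_diff[of H w \<phi> "\<lambda>x. x" a b c] assms by (simp add: compatible_meet_def)
qed

text \<open>Any two elements of \<open>H\<close> share a subtrahend, where both meets have the same
  forced value; extensionality settles arguments outside the carrier.\<close>

lemma compatible_meet_unique:
  assumes w: "compatible_meet M (\<curlywedge>) H \<phi> w"
  shows "w = wH"
proof (rule PiE_ext)
  show "w \<in> carrier H \<rightarrow>\<^sub>E (carrier H \<rightarrow>\<^sub>E carrier H)" "wH \<in> carrier H \<rightarrow>\<^sub>E (carrier H \<rightarrow>\<^sub>E carrier H)"
    using w compatible_meet_wH by (simp_all add: compatible_meet_def)
  then have w_ext: "w x \<in> carrier H \<rightarrow>\<^sub>E carrier H" "wH x \<in> carrier H \<rightarrow>\<^sub>E carrier H"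
    if "x \<in> carrier H" for x
    using that by (blast dest: PiE_mem)+
  fix x assume x: "x \<in> carrier H"
  show "w x = wH x"
  proof (rule PiE_ext)
    fix y assume "y \<in> carrier H"
    with x obtain a b c where "a \<in> carrier M" "b \<in> carrier M" "c \<in> carrier M"
        "x = diff a c" "y = diff b c"
      by (rule diff_cases2)
    then show "w x y = wH x y"
      using w by (simp add: compatible_meet_diff wH_diff)
  qed (rule w_ext[OF x])+
qed

text \<open>A monoid morphism on \<open>H\<close> that extends \<open>f\<close> automatically
  preserves meets, hence joins. The two universal properties therefore single out the same map, and
  that of the Grothendieck group supplies it.\<close>

lemma lattice_ordered_group_universal:
  assumes w: "compatible_meet M (\<curlywedge>) H \<phi> w"
  shows "universal_lattice_ordered_group TYPE('g) M (\<curlywedge>) H w \<phi>"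
  unfolding universal_lattice_ordered_group_def
proof (intro conjI allI impI)
  interpret W: meet_group H w
    using w H.comm_group_axioms by (simp add: compatible_meet_def meet_group_def)
  show "lattice_ordered_group H w"
    by (rule W.lattice_ordered_group)
  show "meet_monoid_hom M (\<curlywedge>) H w \<phi>"
    using w by (simp add: compatible_meet_def)
  fix G :: "'g monoid" and wG f
  assume G: "lattice_ordered_group G wG" and f: "meet_monoid_hom M (\<curlywedge>) G wG f"
  interpret L: lattice_ordered_group G wG by fact
  interpret G: meet_group G wG ..
  have hom_iff: "lattice_ordered_group_hom H w G wG h \<longleftrightarrow> monoid_hom H G h"
    if h: "\<forall>x \<in> carrier M. h (\<phi> x) = f x" for h
  proof
    assume hom: "monoid_hom H G h"
    have "h (w x y) = wG (h x) (h y)" if xy: "x \<in> carrier H" "y \<in> carrier H" for x y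
    proof -
      obtain a b c where "a \<in> carrier M" "b \<in> carrier M" "c \<in> carrier M"
          "x = diff a c" "y = diff b c"
        using diff_cases2[OF xy] .
      then show ?thesis
        using w meet_monoid_hom_diff[OF G.meet_group_axioms f hom] h
        by (simp add: compatible_meet_diff)
    qed
    then show "lattice_ordered_group_hom H w G wG h"
      using hom lattice_ordered_group_hom_iff[OF W.meet_group_axioms G.meet_group_axioms]
      by (simp add: meet_monoid_hom_def)
  qed (simp add: lattice_ordered_group_hom_def meet_monoid_hom_def)
  have "\<exists>!h. h \<in> carrier H \<rightarrow>\<^sub>E carrier G \<and> monoid_hom H G h \<and> (\<forall>x \<in> carrier M. h (\<phi> x) = f x)"
    using grothendieck_group_universal[OF M.comm_monoid_axioms groth, where 'g = 'g]
      L.comm_group_axioms f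
    unfolding universal_group_def meet_monoid_hom_def by blast
  moreover have "h \<in> carrier H \<rightarrow>\<^sub>E carrier G \<and> monoid_hom H G h \<and>
      (\<forall>x \<in> carrier M. h (\<phi> x) = f x) \<longleftrightarrow>
    h \<in> carrier H \<rightarrow>\<^sub>E carrier G \<and> lattice_ordered_group_hom H w G wG h \<and>
      (\<forall>x \<in> carrier M. h (\<phi> x) = f x)" for h
    using hom_iff by blast
  ultimately show "\<exists>!h. h \<in> carrier H \<rightarrow>\<^sub>E carrier G \<and> lattice_ordered_group_hom H w G wG h \<and>
      (\<forall>x \<in> carrier M. h (\<phi> x) = f x)"
    by simp
qed

text \<open>Cancellation removes the witness \<open>e\<close> from
  \<open>phi_eq_iff\<close>.\<close>

lemma phi_inj:
  assumes "\<forall>a \<in> carrier M. \<forall>b \<in> carrier M. \<forall>x \<in> carrier M. a \<otimes> x = b \<otimes> x \<longrightarrow> a = b"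
  shows "inj_on \<phi> (carrier M)"
  using assms by (auto simp: inj_on_def phi_eq_iff)

end

text \<open>The later claims are stated for every compatible meet, of which the first conjunct gives
  exactly one. The type \<open>'g\<close> of the test objects is arbitrary.\<close>

theorem theorem3p3:
  fixes M :: "'m monoid" and wM :: "'m \<Rightarrow> 'm \<Rightarrow> 'm" and H :: "'h monoid" and \<phi> :: "'m \<Rightarrow> 'h"
  assumes "meet_monoid M wM"
    and "grothendieck_group M H \<phi>"
  shows "(\<exists>!wH. compatible_meet M wM H \<phi> wH) \<and>
    (\<forall>wH. compatible_meet M wM H \<phi> wH \<longrightarrow>
       lattice_ordered_group H wH \<and>
       universal_lattice_ordered_group TYPE('g) M wM H wH \<phi> \<and>
       ((\<forall>a \<in> carrier M. \<forall>b \<in> carrier M. \<forall>x \<in> carrier M.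
           a \<otimes>\<^bsub>M\<^esub> x = b \<otimes>\<^bsub>M\<^esub> x \<longrightarrow> a = b) \<longrightarrow>
         meet_monoid_embedding M wM H wH \<phi>))"
proof -
  interpret grothendieck_meet M wM H \<phi>
    using assms
    by (simp add: grothendieck_meet_def grothendieck_meet_axioms_def grothendieck_group_def
        universal_group_def)
  show ?thesis
  proof (intro conjI allI impI)
    show "\<exists>!wH. compatible_meet M wM H \<phi> wH"
      using compatible_meet_wH compatible_meet_unique by blast
  next
    fix w assume w: "compatible_meet M wM H \<phi> w"
    show "universal_lattice_ordered_group TYPE('g) M wM H w \<phi>"
      by (rule lattice_ordered_group_universal[OF w])
    then show "lattice_ordered_group H w"
      by (simp add: universal_lattice_ordered_group_def)
  next
    fix w assume "compatible_meet M wM H \<phi> w"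
      and "\<forall>a \<in> carrier M. \<forall>b \<in> carrier M. \<forall>x \<in> carrier M.
        a \<otimes>\<^bsub>M\<^esub> x = b \<otimes>\<^bsub>M\<^esub> x \<longrightarrow> a = b"
    then show "meet_monoid_embedding M wM H w \<phi>"
      using phi_inj by (simp add: meet_monoid_embedding_def compatible_meet_def)
  qed
qed

end
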